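(* There exist universal constants $c_x, c_y, C > 0$ such that the following holds. Let $f:\mathbb{R}^m\times\mathbb{R}^n\to\mathbb{R}$ be $\ell$-smooth with $f(\mathbf{x},\cdot)$ $\mu$-strongly concave for every $\mathbf{x}\in\mathbb{R}^m$ ($\ell,\mu>0$), and let $\mathcal{Y}\subseteq\mathbb{R}^n$ be a nonempty, closed, convex and bounded set with diameter $D\ge 0$. Put $\kappa=\ell/\mu$, $\Phi(\mathbf{x})=\max_{\mathbf{y}\in\mathcal{Y}}f(\mathbf{x},\mathbf{y})$, assume $\Phi$ is bounded below, and let $\Delta_\Phi=\Phi(\mathbf{x}_0)-\min_{\mathbf{x}}\Phi(\mathbf{x})$. Let $\epsilon>0$ and run two-timescale GDA from $(\mathbf{x}_0,\mathbf{y}_0)\in\mathbb{R}^m\times\mathcal{Y}$ for $T\ge 1$ iterations with stepsizes $$\eta_{\mathbf{x}}=\frac{c_x}{\kappa^2\ell},\qquad \eta_{\mathbf{y}}=\frac{c_y}{\ell}.$$ If $$T\ \ge\ C\,\frac{\kappa^2\ell\Delta_\Phi+\kappa\ell^2D^2}{\epsilon^2},$$ then the algorithm returns an $\epsilon$-stationary point of $\Phi$, in the sense that its output $\hat{\mathbf{x}}$ satisfies $\mathbb{E}\big[\|\nabla\Phi(\hat{\mathbf{x}})\|^2\big]\le\epsilon^2$. In other words, the iteration complexity (also the gradient complexity) of two-timescale GDA to return an $\epsilon$-stationary point is $O\big((\kappa^2\ell\Delta_\Phi+\kappa\ell^2D^2)\epsilon^{-2}\big)$.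
   Context: A function $g$ is $\ell$-smooth if it is differentiable and $\|\nabla g(\mathbf{z})-\nabla g(\mathbf{z}')\|\le\ell\|\mathbf{z}-\mathbf{z}'\|$ for all $\mathbf{z},\mathbf{z}'$ (for $f$: jointly in $(\mathbf{x},\mathbf{y})$). Norms are Euclidean; $\mathcal{P}_{\mathcal{Y}}$ is Euclidean projection onto $\mathcal{Y}$. Under the stated assumptions $\Phi$ is differentiable. A point $\mathbf{x}$ is an $\epsilon$-stationary point of a differentiable $\Phi$ if $\|\nabla\Phi(\mathbf{x})\|\le\epsilon$. "$\min_{\mathbf{x}}\Phi$" is read as the infimum. Two-timescale GDA: given $(\mathbf{x}_0,\mathbf{y}_0)$ and stepsizes $(\eta_{\mathbf{x}},\eta_{\mathbf{y}})$, for $t=1,\dots,T$ set $$\mathbf{x}_t=\mathbf{x}_{t-1}-\eta_{\mathbf{x}}\nabla_{\mathbf{x}}f(\mathbf{x}_{t-1},\mathbf{y}_{t-1}),\qquad \mathbf{y}_t=\mathcal{P}_{\mathcal{Y}}\big(\mathbf{y}_{t-1}+\eta_{\mathbf{y}}\nabla_{\mathbf{y}}f(\mathbf{x}_{t-1},\mathbf{y}_{t-1})\big),$$ and return $\hat{\mathbf{x}}$ drawn uniformly at random from $\{\mathbf{x}_t\}_{t=1}^T$. The expectation is over this draw. "Universal" means independent of $m,n,f,\mathcal{Y},\ell,\mu,D,\epsilon,\mathbf{x}_0,\mathbf{y}_0$. *)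

theory Defs
  imports "HOL-Analysis.Analysis" "HOL-Probability.Probability"
begin

text \<open>
  The constants of the theorem must not depend on the dimensions \<open>m\<close> and \<open>n\<close>, so both
  dimensions have to be quantified inside the scope of an existential quantifier. This
  rules out \<open>real ^ 'm\<close>. Instead, all spaces \<open>\<real>\<^sup>n\<close> are realised inside one
  real inner product space: the finitely supported real sequences with the \<open>\<ell>\<^sup>2\<close> inner
  product, where \<open>\<real>\<^sup>n\<close> is the subspace of the sequences that vanish from index \<open>n\<close> on.
  (The library type of finitely supported functions carries the \<open>\<ell>\<^sup>1\<close> norm.)
\<close>

typedef fseq = "{x :: nat \<Rightarrow> real. finite {i. x i \<noteq> 0}}"
  morphisms coord Abs_fseq
  by (rule exI[of _ "\<lambda>_. 0"]) simp

lemma finite_supp: "finite {i. coord x i \<noteq> 0}"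
  using coord[of x] by simp

lemma fseq_eqI: "(\<And>i. coord x i = coord y i) \<Longrightarrow> x = y"
  by (simp add: coord_inject[symmetric] fun_eq_iff)

instantiation fseq :: real_vector
begin

definition "0 = Abs_fseq (\<lambda>i. 0)"
definition "x + y = Abs_fseq (\<lambda>i. coord x i + coord y i)"
definition "- x = Abs_fseq (\<lambda>i. - coord x i)"
definition "x - y = Abs_fseq (\<lambda>i. coord x i - coord y i)"
definition "scaleR r x = Abs_fseq (\<lambda>i. r * coord x i)"

lemma coord_zero [simp]: "coord 0 i = 0"
  by (simp add: zero_fseq_def Abs_fseq_inverse)

lemma coord_add [simp]: "coord (x + y) i = coord x i + coord y i"
proof -
  have "finite {i. coord x i + coord y i \<noteq> 0}"
    by (rule finite_subset[OF _ finite_UnI[OF finite_supp[of x] finite_supp[of y]]]) auto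
  then show ?thesis
    by (simp add: plus_fseq_def Abs_fseq_inverse)
qed

lemma coord_diff [simp]: "coord (x - y) i = coord x i - coord y i"
proof -
  have "finite {i. coord x i - coord y i \<noteq> 0}"
    by (rule finite_subset[OF _ finite_UnI[OF finite_supp[of x] finite_supp[of y]]]) auto
  then show ?thesis
    by (simp add: minus_fseq_def Abs_fseq_inverse)
qed

lemma coord_minus [simp]: "coord (- x) i = - coord x i"
  using finite_supp[of x] by (simp add: uminus_fseq_def Abs_fseq_inverse)

lemma coord_scaleR [simp]: "coord (r *\<^sub>R x) i = r * coord x i"
proof -
  have "finite {i. r * coord x i \<noteq> 0}"
    by (rule finite_subset[OF _ finite_supp[of x]]) auto
  then show ?thesis
    by (simp add: scaleR_fseq_def Abs_fseq_inverse)
qed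

instance
  by standard (auto intro!: fseq_eqI simp: algebra_simps)

end

instantiation fseq :: real_inner
begin

definition inner_fseq :: "fseq \<Rightarrow> fseq \<Rightarrow> real" where
  "inner_fseq x y = (\<Sum>i | coord x i \<noteq> 0. coord x i * coord y i)"
definition norm_fseq :: "fseq \<Rightarrow> real" where
  "norm_fseq x = sqrt (inner x x)"
definition dist_fseq :: "fseq \<Rightarrow> fseq \<Rightarrow> real" where
  "dist_fseq x y = norm (x - y)"
definition sgn_fseq :: "fseq \<Rightarrow> fseq" where
  "sgn_fseq x = x /\<^sub>R norm x"
definition uniformity_fseq :: "(fseq \<times> fseq) filter" where
  "uniformity_fseq = (INF e\<in>{0<..}. principal {(x, y). dist x y < e})"
definition open_fseq :: "fseq set \<Rightarrow> bool" where
  "open_fseq U \<longleftrightarrow> (\<forall>x\<in>U. \<forall>\<^sub>F (x', y) in uniformity. x' = x \<longrightarrow> y \<in> U)"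

lemma inner_fseq_superset:
  assumes "finite A" "\<And>i. coord x i \<noteq> 0 \<Longrightarrow> i \<in> A"
  shows "inner x y = (\<Sum>i\<in>A. coord x i * coord y i)"
  unfolding inner_fseq_def by (rule sum.mono_neutral_left) (use assms in auto)

instance
proof
  fix x y z :: fseq and r :: real
  let ?A = "{i. coord x i \<noteq> 0} \<union> {i. coord y i \<noteq> 0} \<union> {i. coord z i \<noteq> 0}"
  have A: "finite ?A" by (simp add: finite_supp)
  have x: "inner x w = (\<Sum>i\<in>?A. coord x i * coord w i)" for w
    by (rule inner_fseq_superset[OF A]) auto
  have y: "inner y w = (\<Sum>i\<in>?A. coord y i * coord w i)" for w
    by (rule inner_fseq_superset[OF A]) auto
  have xy: "inner (x + y) w = (\<Sum>i\<in>?A. coord (x + y) i * coord w i)" for w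
    by (rule inner_fseq_superset[OF A]) auto
  have rx: "inner (r *\<^sub>R x) w = (\<Sum>i\<in>?A. coord (r *\<^sub>R x) i * coord w i)" for w
    by (rule inner_fseq_superset[OF A]) auto
  show "inner x y = inner y x"
    unfolding x y by (simp add: mult.commute)
  show "inner (x + y) z = inner x z + inner y z"
    unfolding x y xy by (simp add: distrib_right sum.distrib)
  show "inner (r *\<^sub>R x) y = r * inner x y"
    unfolding x rx by (simp add: sum_distrib_left mult.assoc)
  show "0 \<le> inner x x"
    unfolding x by (rule sum_nonneg) simp
  show "inner x x = 0 \<longleftrightarrow> x = 0"
  proof
    assume "inner x x = 0"
    then have "(\<Sum>i | coord x i \<noteq> 0. coord x i * coord x i) = 0"
      by (simp only: inner_fseq_def)
    then have "\<forall>i\<in>{i. coord x i \<noteq> 0}. coord x i * coord x i = 0"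
      by (subst (asm) sum_nonneg_eq_0_iff[OF finite_supp]) simp_all
    then show "x = 0" by (intro fseq_eqI) auto
  qed (simp add: inner_fseq_def)
qed (rule norm_fseq_def dist_fseq_def sgn_fseq_def uniformity_fseq_def open_fseq_def)+

end

definition Rn :: "nat \<Rightarrow> fseq set" where
  "Rn n = {x. \<forall>i\<ge>n. coord x i = 0}"

lemma Rn_inner: "x \<in> Rn n \<Longrightarrow> inner x y = (\<Sum>i<n. coord x i * coord y i)"
  by (rule inner_fseq_superset) (auto simp: Rn_def not_less[symmetric])

lemma Rn_norm: "x \<in> Rn n \<Longrightarrow> norm x = sqrt (\<Sum>i<n. (coord x i)\<^sup>2)"
  by (simp add: norm_eq_sqrt_inner Rn_inner power2_eq_square)

lemma Rn_coords: "bij_betw (\<lambda>x. restrict (coord x) {..<n}) (Rn n) ({..<n} \<rightarrow>\<^sub>E UNIV)"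
  unfolding bij_betw_def
proof
  show "inj_on (\<lambda>x. restrict (coord x) {..<n}) (Rn n)"
  proof (intro inj_onI fseq_eqI)
    fix x y i
    assume "x \<in> Rn n" "y \<in> Rn n" and eq: "restrict (coord x) {..<n} = restrict (coord y) {..<n}"
    moreover have "coord x i = coord y i" if "i < n"
      using fun_cong[OF eq, of i] that by simp
    ultimately show "coord x i = coord y i"
      by (cases "i < n") (auto simp: Rn_def)
  qed
  show "(\<lambda>x. restrict (coord x) {..<n}) ` Rn n = {..<n} \<rightarrow>\<^sub>E UNIV"
  proof (intro subset_antisym image_subsetI subsetI)
    fix v :: "nat \<Rightarrow> real"
    assume v: "v \<in> {..<n} \<rightarrow>\<^sub>E UNIV"
    define w where "w = Abs_fseq (\<lambda>i. if i < n then v i else 0)"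
    have "finite {i. (if i < n then v i else 0) \<noteq> 0}"
      by (rule finite_subset[of _ "{..<n}"]) (simp_all add: subset_iff)
    then have w: "coord w i = (if i < n then v i else 0)" for i
      unfolding w_def by (subst Abs_fseq_inverse) simp_all
    have "w \<in> Rn n" by (simp add: Rn_def w)
    moreover have "v = restrict (coord w) {..<n}"
      by (intro ext) (simp add: restrict_def w PiE_arb[OF v])
    ultimately show "v \<in> (\<lambda>x. restrict (coord x) {..<n}) ` Rn n" by (rule rev_image_eqI)
  qed simp
qed

lemma subspace_Rn: "subspace (Rn n)"
  by (auto simp: subspace_def Rn_def)

lemma closed_Rn: "closed (Rn n)"
proof -
  have b: "\<bar>coord x i\<bar> \<le> norm x" for x i
  proof -
    have "(coord x i)\<^sup>2 \<le> (\<Sum>j\<in>insert i {j. coord x j \<noteq> 0}. coord x j * coord x j)"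
      unfolding power2_eq_square by (rule member_le_sum) (auto simp: finite_supp)
    also have "\<dots> = inner x x"
      by (rule inner_fseq_superset[symmetric]) (auto simp: finite_supp)
    finally show ?thesis
      unfolding norm_eq_sqrt_inner by (simp add: real_le_rsqrt)
  qed
  have "bounded_linear (\<lambda>x. coord x i)" for i
    by (rule bounded_linear_intro[where K = 1]) (use b in auto)
  then have "closed {x. coord x i = 0}" for i
    by (intro closed_Collect_eq linear_continuous_on continuous_on_const)
  moreover have "Rn n = (\<Inter>i\<in>{n..}. {x. coord x i = 0})"
    by (auto simp: Rn_def)
  ultimately show ?thesis by (auto intro!: closed_INT)
qed

text \<open>
  Gradients of functions on a subspace \<open>S\<close> (here \<open>\<real>\<^sup>n\<close>, or \<open>\<real>\<^sup>m \<times> \<real>\<^sup>n\<close>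
  with the Euclidean product norm): the derivative is taken within \<open>S\<close>, so values outside \<open>S\<close>
  are irrelevant, and the gradient is the vector of \<open>S\<close> representing it.
\<close>

definition has_gradient :: "('a::real_inner \<Rightarrow> real) \<Rightarrow> 'a \<Rightarrow> 'a \<Rightarrow> 'a set \<Rightarrow> bool" where
  "has_gradient f g z S \<longleftrightarrow> g \<in> S \<and> (f has_derivative (\<lambda>h. inner h g)) (at z within S)"

definition gradient :: "'a::real_inner set \<Rightarrow> ('a \<Rightarrow> real) \<Rightarrow> 'a \<Rightarrow> 'a" where
  "gradient S f z = (THE g. has_gradient f g z S)"

lemma has_gradient_unique:
  assumes S: "subspace S" and z: "z \<in> S"
    and g: "has_gradient f g z S" and g': "has_gradient f g' z S"
  shows "g = g'"
proof -
  define d where "d = g - g'"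
  have d: "d \<in> S"
    using S g g' by (simp add: d_def has_gradient_def subspace_diff)
  have line: "((\<lambda>t. z + t *\<^sub>R d) has_derivative (\<lambda>t. t *\<^sub>R d)) (at 0)"
    by (auto intro!: derivative_eq_intros)
  have sub: "(\<lambda>t::real. z + t *\<^sub>R d) ` UNIV \<subseteq> S"
    using S z d by (auto intro: subspace_add subspace_scale)
  have *: "((\<lambda>t. f (z + t *\<^sub>R d)) has_derivative (\<lambda>t. inner (t *\<^sub>R d) k)) (at (0::real))"
    if "has_gradient f k z S" for k
  proof -
    have "(f has_derivative (\<lambda>h. inner h k)) (at (z + 0 *\<^sub>R d) within range (\<lambda>t. z + t *\<^sub>R d))"
      using that sub by (auto simp: has_gradient_def intro: has_derivative_subset)
    from has_derivative_in_compose[OF line this] show ?thesis by (simp add: o_def)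
  qed
  have "(\<lambda>t. inner (t *\<^sub>R d) g) = (\<lambda>t::real. inner (t *\<^sub>R d) g')"
    by (rule has_derivative_unique[OF *[OF g] *[OF g']])
  then have "inner (1 *\<^sub>R d) g = inner (1 *\<^sub>R d) g'" by (rule fun_cong)
  then have "inner d d = 0" by (simp add: d_def inner_diff_right)
  then show ?thesis by (simp add: d_def)
qed

lemma gradient_eq:
  "subspace S \<Longrightarrow> z \<in> S \<Longrightarrow> has_gradient f g z S \<Longrightarrow> gradient S f z = g"
  unfolding gradient_def by (blast intro: has_gradient_unique)

definition l_smooth_on :: "'a::real_inner set \<Rightarrow> real \<Rightarrow> ('a \<Rightarrow> real) \<Rightarrow> bool" where
  "l_smooth_on S l g \<longleftrightarrow> g differentiable_on S \<and>
     (\<forall>z\<in>S. \<forall>z'\<in>S. norm (gradient S g z - gradient S g z') \<le> l * norm (z - z'))"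

definition strongly_concave_on :: "'a::real_inner set \<Rightarrow> real \<Rightarrow> ('a \<Rightarrow> real) \<Rightarrow> bool" where
  "strongly_concave_on S \<mu> g \<longleftrightarrow>
     (\<forall>u\<in>S. \<forall>v\<in>S. \<forall>t\<in>{0..1}.
        g ((1 - t) *\<^sub>R u + t *\<^sub>R v)
          \<ge> (1 - t) * g u + t * g v + \<mu> / 2 * t * (1 - t) * (norm (u - v))\<^sup>2)"

(* The library's closest_point requires a Heine-Borel space, which fseq is not; only
   closed convex subsets of some Rn, where the nearest point is unique, are projected on. *)
definition proj :: "'a::metric_space set \<Rightarrow> 'a \<Rightarrow> 'a" where
  "proj Y a = (THE p. p \<in> Y \<and> (\<forall>y\<in>Y. dist a p \<le> dist a y))"

(* The supremum is attained: f x is continuous and Y is compact and nonempty. *)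
definition max_over :: "'b set \<Rightarrow> ('a \<times> 'b \<Rightarrow> real) \<Rightarrow> 'a \<Rightarrow> real" where
  "max_over Y f x = (SUP y\<in>Y. f (x, y))"

primrec gda :: "nat \<Rightarrow> nat \<Rightarrow> (fseq \<times> fseq \<Rightarrow> real) \<Rightarrow> fseq set \<Rightarrow> real \<Rightarrow> real \<Rightarrow>
    fseq \<Rightarrow> fseq \<Rightarrow> nat \<Rightarrow> fseq \<times> fseq" where
  "gda m n f Y \<eta>x \<eta>y x0 y0 0 = (x0, y0)"
| "gda m n f Y \<eta>x \<eta>y x0 y0 (Suc t) =
     (let (x, y) = gda m n f Y \<eta>x \<eta>y x0 y0 t
      in (x - \<eta>x *\<^sub>R gradient (Rn m) (\<lambda>x'. f (x', y)) x,
          proj Y (y + \<eta>y *\<^sub>R gradient (Rn n) (\<lambda>y'. f (x, y')) y)))"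

definition gda_output :: "nat \<Rightarrow> nat \<Rightarrow> (fseq \<times> fseq \<Rightarrow> real) \<Rightarrow> fseq set \<Rightarrow> real \<Rightarrow> real \<Rightarrow>
    fseq \<Rightarrow> fseq \<Rightarrow> nat \<Rightarrow> fseq pmf" where
  "gda_output m n f Y \<eta>x \<eta>y x0 y0 T =
     map_pmf (\<lambda>t. fst (gda m n f Y \<eta>x \<eta>y x0 y0 t)) (pmf_of_set {1..T})"

end

theory Submission
  imports Defs
begin

text \<open>
  Write \<open>\<eta>\<close> for \<open>\<eta>\<^sub>x\<close>, \<open>y\<^sup>*(x)\<close> for the maximiser of \<open>f(x, \<cdot>)\<close> over \<open>Y\<close> and
  \<open>\<delta>\<^sub>t = \<parallel>y\<^sub>t - y\<^sup>*(x\<^sub>t)\<parallel>\<^sup>2\<close>. The ascent step contracts \<open>\<delta>\<close> by the factor \<open>1 - 1/\<kappa>\<close>, and the motion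
  of \<open>x\<close> perturbs it through the \<open>\<kappa>\<close>-Lipschitz map \<open>y\<^sup>*\<close>; conversely \<open>\<nabla>\<^sub>x f(x\<^sub>t, y\<^sub>t)\<close> differs from
  \<open>\<nabla>\<Phi>(x\<^sub>t)\<close> by at most \<open>l \<surd>\<delta>\<^sub>t\<close>. Both errors are absorbed by the Lyapunov function
  \<open>V = \<Phi>(x) + \<kappa> \<eta> l\<^sup>2 \<delta>\<close>, which decreases by at least \<open>\<eta>/2 \<parallel>\<nabla>\<Phi>(x\<^sub>t)\<parallel>\<^sup>2\<close> at each step, and telescoping
  gives the rate. Smoothness of \<open>\<nabla>\<Phi>\<close> is never needed, only a quadratic model of \<open>\<Phi>\<close> around each point.
\<close>

section \<open>Gradients on a subspace\<close>

text \<open>Young's inequality, read off from the square of \<open>u - k *\<^sub>R v\<close>. The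
  free weight \<open>k\<close> is later tuned against the contraction factor.\<close>

lemma norm_add_sq_le:
  fixes u v :: "'a::real_inner"
  assumes "0 < k"
  shows "(norm (u + v))\<^sup>2 \<le> (1 + 1 / k) * (norm u)\<^sup>2 + (1 + k) * (norm v)\<^sup>2"
proof -
  have "0 \<le> (norm (u - k *\<^sub>R v))\<^sup>2" by simp
  also have "\<dots> = (norm u)\<^sup>2 - 2 * k * inner u v + k\<^sup>2 * (norm v)\<^sup>2"
    unfolding power2_norm_eq_inner by (simp add: algebra_simps inner_commute power2_eq_square)
  finally have "2 * inner u v \<le> (norm u)\<^sup>2 / k + k * (norm v)\<^sup>2"
    using assms by (simp add: field_simps power2_eq_square)
  moreover have "(norm (u + v))\<^sup>2 = (norm u)\<^sup>2 + 2 * inner u v + (norm v)\<^sup>2"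
    by (simp add: power2_norm_eq_inner algebra_simps inner_commute)
  ultimately show ?thesis by (simp add: algebra_simps)
qed

text \<open>Reduces estimates on \<open>S\<close> to one real variable: the whole line stays in
  \<open>S\<close>, so a derivative within \<open>S\<close> obeys the chain rule along it.\<close>

lemma has_gradient_line:
  assumes S: "subspace S" and u: "u \<in> S" and d: "d \<in> S"
    and g: "has_gradient f g (u + t *\<^sub>R d) S"
  shows "((\<lambda>t. f (u + t *\<^sub>R d)) has_real_derivative inner d g) (at t)"
proof -
  have line: "((\<lambda>t. u + t *\<^sub>R d) has_derivative (\<lambda>t. t *\<^sub>R d)) (at t)"
    by (auto intro!: derivative_eq_intros)
  have sub: "range (\<lambda>t::real. u + t *\<^sub>R d) \<subseteq> S"
    using S u d by (auto intro: subspace_add subspace_scale)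
  have "(f has_derivative (\<lambda>h. inner h g)) (at (u + t *\<^sub>R d) within range (\<lambda>t. u + t *\<^sub>R d))"
    using g sub by (auto simp: has_gradient_def intro: has_derivative_subset)
  from has_derivative_in_compose[OF line this]
  have "((\<lambda>t. f (u + t *\<^sub>R d)) has_derivative (\<lambda>t. inner (t *\<^sub>R d) g)) (at t)"
    by (simp add: o_def)
  then show ?thesis
    by (simp add: has_field_derivative_def mult_commute_abs)
qed

text \<open>The descent lemma, by monotonicity instead of integration: along the segment the gap to
  the quadratic model has derivative at most 0, by Cauchy-Schwarz and the Lipschitz bound.\<close>

lemma smooth_upper_bound:
  assumes S: "subspace S" and u: "u \<in> S" and v: "v \<in> S"
    and g: "\<And>z. z \<in> S \<Longrightarrow> has_gradient f (g z) z S"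
    and lip: "\<And>z z'. z \<in> S \<Longrightarrow> z' \<in> S \<Longrightarrow> norm (g z - g z') \<le> l * norm (z - z')"
  shows "f v \<le> f u + inner (v - u) (g u) + l / 2 * (norm (v - u))\<^sup>2"
proof -
  define d where "d = v - u"
  have d: "d \<in> S" using S u v by (simp add: d_def subspace_diff)
  have on_line: "u + t *\<^sub>R d \<in> S" for t
    using S u d by (auto intro: subspace_add subspace_scale)
  let ?h = "\<lambda>t. f (u + t *\<^sub>R d) - t * inner d (g u) - l / 2 * t\<^sup>2 * (norm d)\<^sup>2"
  have "\<exists>y. (?h has_real_derivative y) (at t) \<and> y \<le> 0" if "0 \<le> t" for t
  proof (intro exI conjI)
    show "(?h has_real_derivative
        inner d (g (u + t *\<^sub>R d)) - inner d (g u) - l * t * (norm d)\<^sup>2) (at t)"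
      by (auto intro!: derivative_eq_intros has_gradient_line[OF S u d g[OF on_line]])
    have "inner d (g (u + t *\<^sub>R d)) - inner d (g u) \<le> norm d * norm (g (u + t *\<^sub>R d) - g u)"
      by (simp add: inner_diff_right[symmetric] norm_cauchy_schwarz)
    also have "\<dots> \<le> norm d * (l * norm (u + t *\<^sub>R d - u))"
      by (intro mult_left_mono lip on_line u) auto
    also have "\<dots> = l * t * (norm d)\<^sup>2"
      using that by (simp add: power2_eq_square)
    finally show "inner d (g (u + t *\<^sub>R d)) - inner d (g u) - l * t * (norm d)\<^sup>2 \<le> 0" by simp
  qed
  then have "?h 1 \<le> ?h 0" by (intro DERIV_nonpos_imp_nonincreasing[of 0 1 ?h] zero_le_one)
  then show ?thesis by (simp add: d_def)
qed

lemma smooth_lower_bound: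
  assumes S: "subspace S" and u: "u \<in> S" and v: "v \<in> S"
    and g: "\<And>z. z \<in> S \<Longrightarrow> has_gradient f (g z) z S"
    and lip: "\<And>z z'. z \<in> S \<Longrightarrow> z' \<in> S \<Longrightarrow> norm (g z - g z') \<le> l * norm (z - z')"
  shows "f u + inner (v - u) (g u) - l / 2 * (norm (v - u))\<^sup>2 \<le> f v"
proof -
  have "has_gradient (\<lambda>z. - f z) (- g z) z S" if "z \<in> S" for z
    using g[OF that] S by (auto simp: has_gradient_def subspace_neg intro!: derivative_eq_intros)
  moreover have "norm (- g z - - g z') \<le> l * norm (z - z')" if "z \<in> S" "z' \<in> S" for z z'
    using lip[OF that] by (simp add: norm_minus_commute)
  ultimately have "- f v \<le> - f u + inner (v - u) (- g u) + l / 2 * (norm (v - u))\<^sup>2"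
    using smooth_upper_bound[OF S u v, of "\<lambda>z. - f z" "\<lambda>z. - g z" l] by blast
  then show ?thesis by simp
qed

lemma has_gradient_fst:
  assumes "has_gradient f g (x, y) (X \<times> S)" "x \<in> X" "y \<in> S"
  shows "has_gradient (\<lambda>x'. f (x', y)) (fst g) x X"
proof -
  have "((\<lambda>x'. (x', y)) has_derivative (\<lambda>h. (h, 0))) (at x within X)"
    by (auto intro!: derivative_eq_intros)
  moreover have "(f has_derivative (\<lambda>h. inner h g)) (at (x, y) within (\<lambda>x'. (x', y)) ` X)"
    using assms by (auto simp: has_gradient_def intro: has_derivative_subset)
  ultimately have "((\<lambda>x'. f (x', y)) has_derivative (\<lambda>h. inner (h, 0) g)) (at x within X)"
    by (rule has_derivative_in_compose)
  then show ?thesis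
    using assms by (auto simp: has_gradient_def inner_prod_def)
qed

lemma has_gradient_snd:
  assumes "has_gradient f g (x, y) (X \<times> S)" "x \<in> X" "y \<in> S"
  shows "has_gradient (\<lambda>y'. f (x, y')) (snd g) y S"
proof -
  have "((\<lambda>y'. (x, y')) has_derivative (\<lambda>h. (0, h))) (at y within S)"
    by (auto intro!: derivative_eq_intros)
  moreover have "(f has_derivative (\<lambda>h. inner h g)) (at (x, y) within (\<lambda>y'. (x, y')) ` S)"
    using assms by (auto simp: has_gradient_def intro: has_derivative_subset)
  ultimately have "((\<lambda>y'. f (x, y')) has_derivative (\<lambda>h. inner (0, h) g)) (at y within S)"
    by (rule has_derivative_in_compose)
  then show ?thesis
    using assms by (auto simp: has_gradient_def inner_prod_def)
qed

text \<open>A linear model with quadratic error forces differentiability. This is what turns two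
  one-sided models of \<Phi> into a gradient.\<close>

lemma has_gradient_of_quadratic_bound:
  assumes g: "g \<in> S"
    and bound: "\<And>x'. x' \<in> S \<Longrightarrow> \<bar>f x' - f x - inner (x' - x) g\<bar> \<le> c * (norm (x' - x))\<^sup>2"
  shows "has_gradient f g x S"
  unfolding has_gradient_def
proof (intro conjI g has_derivativeI_sandwich[where e = 1 and H = "\<lambda>x'. c * norm (x' - x)"])
  show "bounded_linear (\<lambda>h. inner h g)" by (rule bounded_linear_inner_left)
  show "norm (f x' - f x - inner (x' - x) g) / norm (x' - x) \<le> c * norm (x' - x)"
    if "x' \<in> S" "x' \<noteq> x" for x'
    using bound[OF that(1)] that(2) by (simp add: field_simps power2_eq_square)
  have "((\<lambda>x'. c * norm (x' - x)) \<longlongrightarrow> c * norm (x - x)) (at x within S)"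
    by (intro tendsto_intros)
  then show "((\<lambda>x'. c * norm (x' - x)) \<longlongrightarrow> 0) (at x within S)" by simp
qed simp

section \<open>Strong concavity and projections\<close>

text \<open>Divide the concavity inequality at \<open>u + t *\<^sub>R d\<close> by \<open>t\<close>
  and let \<open>t\<close> tend to 0 from the right.\<close>

lemma strongly_concave_gradient:
  assumes S: "subspace S" and u: "u \<in> S" and v: "v \<in> S"
    and conc: "strongly_concave_on S \<mu> f" and g: "has_gradient f g u S"
  shows "f v \<le> f u + inner (v - u) g - \<mu> / 2 * (norm (v - u))\<^sup>2"
proof -
  define d where "d = v - u"
  have d: "d \<in> S" using S u v by (simp add: d_def subspace_diff)
  have "((\<lambda>t. f (u + t *\<^sub>R d)) has_real_derivative inner d g) (at 0)"
    using has_gradient_line[OF S u d, of f g 0] g by simp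
  then have "((\<lambda>t. (f (u + t *\<^sub>R d) - f u) / t) \<longlongrightarrow> inner d g) (at_right 0)"
    by (auto simp: DERIV_def intro: filterlim_mono at_le)
  moreover have "((\<lambda>t. f v - f u + \<mu> / 2 * (1 - t) * (norm d)\<^sup>2) \<longlongrightarrow>
      f v - f u + \<mu> / 2 * (1 - 0) * (norm d)\<^sup>2) (at_right 0)"
    by (intro tendsto_intros)
  moreover have "\<forall>\<^sub>F t in at_right 0.
      f v - f u + \<mu> / 2 * (1 - t) * (norm d)\<^sup>2 \<le> (f (u + t *\<^sub>R d) - f u) / t"
    using eventually_at_right_less[of 0] eventually_at_right_real[of 0 "1::real", OF zero_less_one]
  proof eventually_elim
    case (elim t)
    have "(1 - t) * f u + t * f v + \<mu> / 2 * t * (1 - t) * (norm (u - v))\<^sup>2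
        \<le> f ((1 - t) *\<^sub>R u + t *\<^sub>R v)"
      using conc u v elim by (auto simp: strongly_concave_on_def)
    moreover have "(1 - t) *\<^sub>R u + t *\<^sub>R v = u + t *\<^sub>R d"
      by (simp add: d_def algebra_simps)
    ultimately have "t * (f v - f u + \<mu> / 2 * (1 - t) * (norm d)\<^sup>2) \<le> f (u + t *\<^sub>R d) - f u"
      by (simp add: d_def norm_minus_commute algebra_simps)
    then show ?case using elim by (simp add: pos_le_divide_eq mult.commute)
  qed
  ultimately have "f v - f u + \<mu> / 2 * (1 - 0) * (norm d)\<^sup>2 \<le> inner d g"
    by (intro tendsto_le[OF trivial_limit_at_right_real])
  then show ?thesis by (simp add: d_def)
qed

text \<open>The same limit, but now maximality of \<open>p\<close> over \<open>Y\<close> bounds the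
  value at the intermediate point, so maximisers on the boundary of \<open>Y\<close> are
  covered.\<close>

lemma strongly_concave_quadratic_growth:
  assumes conc: "strongly_concave_on S \<mu> f" and Y: "Y \<subseteq> S" "convex Y"
    and p: "p \<in> Y" "\<And>y. y \<in> Y \<Longrightarrow> f y \<le> f p" and y: "y \<in> Y"
  shows "f y + \<mu> / 2 * (norm (y - p))\<^sup>2 \<le> f p"
proof -
  have "((\<lambda>t. f y + \<mu> / 2 * (1 - t) * (norm (y - p))\<^sup>2) \<longlongrightarrow>
      f y + \<mu> / 2 * (1 - 0) * (norm (y - p))\<^sup>2) (at_right 0)"
    by (intro tendsto_intros)
  moreover have "\<forall>\<^sub>F t in at_right 0. f y + \<mu> / 2 * (1 - t) * (norm (y - p))\<^sup>2 \<le> f p"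
    using eventually_at_right_less[of 0] eventually_at_right_real[of 0 "1::real", OF zero_less_one]
  proof eventually_elim
    case (elim t)
    have "(1 - t) * f p + t * f y + \<mu> / 2 * t * (1 - t) * (norm (p - y))\<^sup>2
        \<le> f ((1 - t) *\<^sub>R p + t *\<^sub>R y)"
      using p y Y elim
      by (intro conc[unfolded strongly_concave_on_def, rule_format]) auto
    also have "\<dots> \<le> f p"
      using p y Y elim by (intro p(2)) (auto simp: convex_alt)
    finally have "t * (f y + \<mu> / 2 * (1 - t) * (norm (y - p))\<^sup>2) \<le> t * f p"
      by (simp add: norm_minus_commute algebra_simps)
    then show ?case using elim by simp
  qed
  ultimately have "f y + \<mu> / 2 * (1 - 0) * (norm (y - p))\<^sup>2 \<le> f p"
    by (intro tendsto_upperbound[OF _ _ trivial_limit_at_right_real])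
  then show ?thesis by simp
qed

text \<open>Compactness gives a nearest point and convexity its uniqueness, so the description in
  \<open>proj\<close> denotes it. The second claim is the obtuse-angle criterion.\<close>

lemma proj_compact_convex:
  fixes Y :: "'a::real_inner set"
  assumes "compact Y" "convex Y" "Y \<noteq> {}"
  shows "proj Y a \<in> Y" and "y \<in> Y \<Longrightarrow> inner (a - proj Y a) (y - proj Y a) \<le> 0"
proof -
  have "continuous_on Y (dist a)" by (intro continuous_intros)
  then obtain p where p: "p \<in> Y" "\<forall>y\<in>Y. dist a p \<le> dist a y"
    using continuous_attains_inf[of Y "dist a"] assms by blast
  have "proj Y a = p"
    unfolding proj_def
    using p any_closest_point_unique[OF \<open>convex Y\<close> compact_imp_closed[OF \<open>compact Y\<close>]]
    by (intro the_equality) blast+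
  then show "proj Y a \<in> Y" and "y \<in> Y \<Longrightarrow> inner (a - proj Y a) (y - proj Y a) \<le> 0"
    using p any_closest_point_dot[OF \<open>convex Y\<close> compact_imp_closed[OF \<open>compact Y\<close>]] by auto
qed

section \<open>One step of gradient descent ascent\<close>

text \<open>\<open>G\<close> stands for the joint gradient on a product of two subspaces. The
  assumption \<mu> \<le> \<open>l\<close> says that \<kappa> \<ge> 1, which later allows lower
  powers of \<kappa> to be bounded by higher ones.\<close>

locale minimax =
  fixes f :: "'a::real_inner \<times> 'b::real_inner \<Rightarrow> real" and X :: "'a set" and S Y :: "'b set"
    and G :: "'a \<times> 'b \<Rightarrow> 'a \<times> 'b" and l \<mu> :: real
  assumes X: "subspace X" and S: "subspace S" and \<mu>_pos: "0 < \<mu>" and \<mu>_le: "\<mu> \<le> l"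
    and grad: "z \<in> X \<times> S \<Longrightarrow> has_gradient f (G z) z (X \<times> S)"
    and lip: "z \<in> X \<times> S \<Longrightarrow> z' \<in> X \<times> S \<Longrightarrow> norm (G z - G z') \<le> l * norm (z - z')"
    and conc: "x \<in> X \<Longrightarrow> strongly_concave_on S \<mu> (\<lambda>y. f (x, y))"
    and Y: "Y \<subseteq> S" "Y \<noteq> {}" "compact Y" "convex Y"
begin

section \<open>Partial gradients and their Lipschitz bounds\<close>

definition Gx :: "'a \<Rightarrow> 'b \<Rightarrow> 'a" where "Gx x y = fst (G (x, y))"
definition Gy :: "'a \<Rightarrow> 'b \<Rightarrow> 'b" where "Gy x y = snd (G (x, y))"

lemma l_pos: "0 < l" using \<mu>_pos \<mu>_le by simp

lemma has_gradient_Gx: "x \<in> X \<Longrightarrow> y \<in> S \<Longrightarrow> has_gradient (\<lambda>x'. f (x', y)) (Gx x y) x X"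
  unfolding Gx_def by (rule has_gradient_fst[OF grad]) auto

lemma has_gradient_Gy: "x \<in> X \<Longrightarrow> y \<in> S \<Longrightarrow> has_gradient (\<lambda>y'. f (x, y')) (Gy x y) y S"
  unfolding Gy_def by (rule has_gradient_snd[OF grad]) auto

lemma Gx_in: "x \<in> X \<Longrightarrow> y \<in> S \<Longrightarrow> Gx x y \<in> X"
  using has_gradient_Gx by (simp add: has_gradient_def)

lemma
  assumes "x \<in> X" "x' \<in> X" "y \<in> S" "y' \<in> S"
  shows Gx_lip: "norm (Gx x y - Gx x' y') \<le> l * norm ((x, y) - (x', y'))"
    and Gy_lip: "norm (Gy x y - Gy x' y') \<le> l * norm ((x, y) - (x', y'))"
proof -
  have *: "norm (G (x, y) - G (x', y')) \<le> l * norm ((x, y) - (x', y'))"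
    using assms by (intro lip) auto
  show "norm (Gx x y - Gx x' y') \<le> l * norm ((x, y) - (x', y'))"
    unfolding Gx_def fst_diff[symmetric]
    by (rule order_trans[OF _ *]) (metis norm_fst_le prod.collapse)
  show "norm (Gy x y - Gy x' y') \<le> l * norm ((x, y) - (x', y'))"
    unfolding Gy_def snd_diff[symmetric]
    by (rule order_trans[OF _ *]) (metis norm_snd_le prod.collapse)
qed

lemma Gx_lip1: "x \<in> X \<Longrightarrow> x' \<in> X \<Longrightarrow> y \<in> S \<Longrightarrow> norm (Gx x y - Gx x' y) \<le> l * norm (x - x')"
  using Gx_lip[of x x' y y] by (simp add: norm_Pair)

lemma Gx_lip2: "x \<in> X \<Longrightarrow> y \<in> S \<Longrightarrow> y' \<in> S \<Longrightarrow> norm (Gx x y - Gx x y') \<le> l * norm (y - y')"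
  using Gx_lip[of x x y y'] by (simp add: norm_Pair)

lemma Gy_lip2: "x \<in> X \<Longrightarrow> y \<in> S \<Longrightarrow> y' \<in> S \<Longrightarrow> norm (Gy x y - Gy x y') \<le> l * norm (y - y')"
  using Gy_lip[of x x y y'] by (simp add: norm_Pair)

text \<open>In the first argument, the difference of the slices at \<open>a\<close> and
  \<open>b\<close> has a gradient of norm at most \<open>l * norm (a - b)\<close>. This feeds the
  Lipschitz bound for the maximiser.\<close>

lemma mixed_difference_le:
  assumes x: "x \<in> X" and x': "x' \<in> X" and a: "a \<in> S" and b: "b \<in> S"
  shows "(f (x, a) - f (x, b)) - (f (x', a) - f (x', b)) \<le> l * norm (x - x') * norm (a - b)"
proof -
  define d where "d = x - x'"
  have d: "d \<in> X" using X x x' by (simp add: d_def subspace_diff)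
  have on_line: "x' + t *\<^sub>R d \<in> X" for t
    using X x' d by (auto intro: subspace_add subspace_scale)
  let ?h = "\<lambda>t. f (x' + t *\<^sub>R d, a) - f (x' + t *\<^sub>R d, b) - t * (l * norm d * norm (a - b))"
  have "\<exists>y. (?h has_real_derivative y) (at t) \<and> y \<le> 0" for t
  proof (intro exI conjI)
    show "(?h has_real_derivative
        inner d (Gx (x' + t *\<^sub>R d) a) - inner d (Gx (x' + t *\<^sub>R d) b) - l * norm d * norm (a - b)) (at t)"
      by (auto intro!: derivative_eq_intros
          has_gradient_line[OF X x' d has_gradient_Gx[OF on_line a]]
          has_gradient_line[OF X x' d has_gradient_Gx[OF on_line b]])
    have "inner d (Gx (x' + t *\<^sub>R d) a) - inner d (Gx (x' + t *\<^sub>R d) b)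
        \<le> norm d * norm (Gx (x' + t *\<^sub>R d) a - Gx (x' + t *\<^sub>R d) b)"
      by (simp add: inner_diff_right[symmetric] norm_cauchy_schwarz)
    also have "\<dots> \<le> norm d * (l * norm (a - b))"
      by (intro mult_left_mono Gx_lip2 on_line a b) auto
    finally show "inner d (Gx (x' + t *\<^sub>R d) a) - inner d (Gx (x' + t *\<^sub>R d) b)
        - l * norm d * norm (a - b) \<le> 0" by (simp add: algebra_simps)
  qed
  then have "?h 1 \<le> ?h 0" by (intro DERIV_nonpos_imp_nonincreasing[of 0 1 ?h] zero_le_one)
  then show ?thesis by (simp add: d_def)
qed

section \<open>The inner maximiser and the value function\<close>

definition ystar :: "'a \<Rightarrow> 'b" where
  "ystar x = (SOME p. p \<in> Y \<and> (\<forall>y\<in>Y. f (x, y) \<le> f (x, p)))"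

lemma
  assumes "x \<in> X"
  shows ystar_in: "ystar x \<in> Y" and ystar_max: "y \<in> Y \<Longrightarrow> f (x, y) \<le> f (x, ystar x)"
proof -
  have "continuous_on S (\<lambda>y. f (x, y))"
    unfolding continuous_on_eq_continuous_within
  proof
    fix y assume "y \<in> S"
    from has_gradient_Gy[OF assms this] show "continuous (at y within S) (\<lambda>y. f (x, y))"
      unfolding has_gradient_def by (blast intro: has_derivative_continuous)
  qed
  then have "continuous_on Y (\<lambda>y. f (x, y))"
    using Y continuous_on_subset by blast
  then have "\<exists>p. p \<in> Y \<and> (\<forall>y\<in>Y. f (x, y) \<le> f (x, p))"
    using continuous_attains_sup[of Y] Y by blast
  from someI_ex[OF this]
  show "ystar x \<in> Y" and "y \<in> Y \<Longrightarrow> f (x, y) \<le> f (x, ystar x)"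
    unfolding ystar_def by auto
qed

lemma ystar_in_S: "x \<in> X \<Longrightarrow> ystar x \<in> S" using ystar_in Y by blast

abbreviation \<Phi> :: "'a \<Rightarrow> real" where "\<Phi> \<equiv> max_over Y f"

lemma \<Phi>_eq: "x \<in> X \<Longrightarrow> \<Phi> x = f (x, ystar x)"
  unfolding max_over_def by (rule cSup_eq_maximum) (use ystar_in ystar_max in auto)

text \<open>Strong concavity makes the maximiser unique by this bound, so the choice in
  \<open>ystar\<close> is immaterial.\<close>

lemma ystar_growth:
  "x \<in> X \<Longrightarrow> y \<in> Y \<Longrightarrow> f (x, y) + \<mu> / 2 * (norm (y - ystar x))\<^sup>2 \<le> f (x, ystar x)"
  using strongly_concave_quadratic_growth[OF conc Y(1,4) ystar_in ystar_max] by blast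

text \<open>Adding the quadratic growth at both maximisers bounds \<mu> times their squared distance
  by a mixed difference, which is only linear in that distance; one factor cancels.\<close>

lemma ystar_lip:
  assumes x: "x \<in> X" and x': "x' \<in> X"
  shows "norm (ystar x - ystar x') \<le> l / \<mu> * norm (x - x')"
proof (cases "ystar x = ystar x'")
  case False
  let ?d = "norm (ystar x - ystar x')"
  have "\<mu> * ?d\<^sup>2 \<le> (f (x, ystar x) - f (x, ystar x')) - (f (x', ystar x) - f (x', ystar x'))"
    using ystar_growth[OF x ystar_in[OF x']] ystar_growth[OF x' ystar_in[OF x]]
    by (simp add: norm_minus_commute field_simps)
  also have "\<dots> \<le> l * norm (x - x') * ?d"
    using x x' by (intro mixed_difference_le ystar_in_S)
  finally have "\<mu> * ?d \<le> l * norm (x - x')"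
    using False by (simp add: power2_eq_square mult.assoc[symmetric])
  then show ?thesis using \<mu>_pos by (simp add: field_simps)
qed (use l_pos \<mu>_pos in simp)

text \<open>Freezing the second argument at \<open>ystar x\<close> gives a smooth minorant of \<Phi>
  that touches it at \<open>x\<close>.\<close>

lemma \<Phi>_lower:
  assumes x: "x \<in> X" and x': "x' \<in> X"
  shows "\<Phi> x + inner (x' - x) (Gx x (ystar x)) - l / 2 * (norm (x' - x))\<^sup>2 \<le> \<Phi> x'"
proof -
  have "f (x, ystar x) + inner (x' - x) (Gx x (ystar x)) - l / 2 * (norm (x' - x))\<^sup>2
      \<le> f (x', ystar x)"
    by (rule smooth_lower_bound[OF X x x', where f = "\<lambda>z. f (z, ystar x)" and g = "\<lambda>z. Gx z (ystar x)"])
      (use x in \<open>auto intro: has_gradient_Gx Gx_lip1 ystar_in_S\<close>)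
  then show ?thesis
    using ystar_max[OF x' ystar_in[OF x]] x x' by (simp add: \<Phi>_eq)
qed

text \<open>Now the second argument is frozen at \<open>ystar x'\<close>, which is at best optimal
  at \<open>x\<close>. The linear term then carries the gradient at \<open>ystar x'\<close>; moving
  it to \<open>ystar x\<close> costs the term with \<open>l / \<mu>\<close>, by the Lipschitz bound
  for \<open>ystar\<close>.\<close>

lemma \<Phi>_upper:
  assumes x: "x \<in> X" and x': "x' \<in> X"
  shows "\<Phi> x' \<le> \<Phi> x + inner (x' - x) (Gx x (ystar x)) + (l * (l / \<mu>) + l / 2) * (norm (x' - x))\<^sup>2"
proof -
  let ?y = "ystar x" and ?y' = "ystar x'"
  have "f (x', ?y') \<le> f (x, ?y') + inner (x' - x) (Gx x ?y') + l / 2 * (norm (x' - x))\<^sup>2"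
    by (rule smooth_upper_bound[OF X x x', where f = "\<lambda>z. f (z, ?y')" and g = "\<lambda>z. Gx z ?y'"])
      (use x' in \<open>auto intro: has_gradient_Gx Gx_lip1 ystar_in_S\<close>)
  moreover have "f (x, ?y') \<le> f (x, ?y)"
    using ystar_max[OF x ystar_in[OF x']] .
  moreover have "inner (x' - x) (Gx x ?y') - inner (x' - x) (Gx x ?y) \<le> l * (l / \<mu>) * (norm (x' - x))\<^sup>2"
  proof -
    have "inner (x' - x) (Gx x ?y') - inner (x' - x) (Gx x ?y) \<le> norm (x' - x) * norm (Gx x ?y' - Gx x ?y)"
      by (simp add: inner_diff_right[symmetric] norm_cauchy_schwarz)
    also have "\<dots> \<le> norm (x' - x) * (l * (l / \<mu> * norm (x' - x)))"
      using x x' l_pos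
      by (intro mult_left_mono order_trans[OF Gx_lip2] ystar_lip ystar_in_S) auto
    finally show ?thesis by (simp add: power2_eq_square algebra_simps)
  qed
  ultimately show ?thesis using x x' by (simp add: \<Phi>_eq algebra_simps)
qed

text \<open>Danskin's formula: the lower and upper models of \<Phi> around \<open>x\<close> share
  their linear part.\<close>

lemma has_gradient_\<Phi>:
  assumes x: "x \<in> X"
  shows "has_gradient \<Phi> (Gx x (ystar x)) x X"
proof (rule has_gradient_of_quadratic_bound)
  show "Gx x (ystar x) \<in> X" using x by (intro Gx_in ystar_in_S)
  fix x' assume x': "x' \<in> X"
  \<comment> \<open>Widens the lower model to the constant of the upper one.\<close>
  have "0 \<le> l * (l / \<mu>) * (norm (x' - x))\<^sup>2" using l_pos \<mu>_pos by simp
  then show "\<bar>\<Phi> x' - \<Phi> x - inner (x' - x) (Gx x (ystar x))\<bar>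
      \<le> (l * (l / \<mu>) + l / 2) * (norm (x' - x))\<^sup>2"
    using \<Phi>_lower[OF x x'] \<Phi>_upper[OF x x'] by (simp add: algebra_simps)
qed

text \<open>Treating the projected step as a proximal gradient step gives the contraction from the
  quadratic upper and lower models of \<open>f(x, \<cdot>)\<close> alone, without cocoercivity of its gradient.\<close>

lemma ascent_contraction:
  assumes x: "x \<in> X" and y: "y \<in> Y"
  defines "p \<equiv> proj Y (y + (1 / l) *\<^sub>R Gy x y)"
  shows "l * (norm (p - ystar x))\<^sup>2 \<le> (l - \<mu>) * (norm (y - ystar x))\<^sup>2"
proof -
  let ?s = "ystar x"
  note P = proj_compact_convex[OF Y(3,4,2)]
  have pY: "p \<in> Y" unfolding p_def by (rule P)
  have yS: "y \<in> S" "p \<in> S" using y pY Y by auto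
  have "f (x, y) + inner (p - y) (Gy x y) - l / 2 * (norm (p - y))\<^sup>2 \<le> f (x, p)"
    by (rule smooth_lower_bound[OF S yS, where f = "\<lambda>z. f (x, z)" and g = "Gy x"])
      (use x in \<open>auto intro: has_gradient_Gy Gy_lip2\<close>)
  moreover have "f (x, ?s) \<le> f (x, y) + inner (?s - y) (Gy x y) - \<mu> / 2 * (norm (?s - y))\<^sup>2"
    using x yS
    by (intro strongly_concave_gradient[OF S, where f = "\<lambda>z. f (x, z)"] conc has_gradient_Gy ystar_in_S)
  moreover have "f (x, p) \<le> f (x, ?s)" using x pY by (rule ystar_max)
  \<comment> \<open>The obtuse-angle criterion for \<open>p\<close>, tested with the maximiser and
    scaled by \<open>l\<close>.\<close>
  moreover have "inner (?s - p) (Gy x y) \<le> l * inner (p - y) (?s - p)"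
  proof -
    have "inner (y + (1 / l) *\<^sub>R Gy x y - p) (?s - p) \<le> 0"
      unfolding p_def by (rule P(2)) (use x in \<open>rule ystar_in\<close>)
    then have "(1 / l) * inner (Gy x y) (?s - p) \<le> inner (p - y) (?s - p)"
      by (simp add: inner_diff_left inner_add_left)
    then show ?thesis using l_pos by (simp add: field_simps inner_commute)
  qed
  \<comment> \<open>Three-point identity. At stepsize \<open>1 / l\<close> its term in
    \<open>p - y\<close> cancels exactly the error of the lower quadratic model.\<close>
  moreover have "2 * inner (p - y) (?s - p) =
      (norm (y - ?s))\<^sup>2 - (norm (p - y))\<^sup>2 - (norm (p - ?s))\<^sup>2"
    by (simp add: power2_norm_eq_inner algebra_simps inner_commute)
  then have "2 * (l * inner (p - y) (?s - p)) =
      l * ((norm (y - ?s))\<^sup>2 - (norm (p - y))\<^sup>2 - (norm (p - ?s))\<^sup>2)"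
    by (simp only: mult.left_commute[of 2])
  ultimately show ?thesis
    by (simp add: norm_minus_commute[of ?s] inner_diff_left algebra_simps)
qed

section \<open>Decrease of the Lyapunov function\<close>

definition V :: "real \<Rightarrow> 'a \<Rightarrow> 'b \<Rightarrow> real" where
  "V \<eta> x y = \<Phi> x + l / \<mu> * \<eta> * l\<^sup>2 * (norm (y - ystar x))\<^sup>2"

lemma V_decrease:
  assumes x: "x \<in> X" and y: "y \<in> Y"
  defines "\<eta> \<equiv> (1 / 6) / ((l / \<mu>)\<^sup>2 * l)"
  defines "x' \<equiv> x - \<eta> *\<^sub>R Gx x y" and "y' \<equiv> proj Y (y + (1 / l) *\<^sub>R Gy x y)"
  shows "V \<eta> x' y' \<le> V \<eta> x y - \<eta> / 2 * (norm (Gx x (ystar x)))\<^sup>2"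
proof -
  define k where "k = l / \<mu>"
  define N where "N = (norm (Gx x y))\<^sup>2"
  define \<delta> where "\<delta> = (norm (y - ystar x))\<^sup>2"
  define \<delta>' where "\<delta>' = (norm (y' - ystar x'))\<^sup>2"
  let ?g = "Gx x y" and ?G = "Gx x (ystar x)"
  have k: "1 \<le> k" "0 < k" using \<mu>_pos \<mu>_le by (auto simp: k_def)
  have nonneg: "0 \<le> N" "0 \<le> \<delta>" by (auto simp: N_def \<delta>_def)
  \<comment> \<open>Both error terms in \<open>N\<close> below are rewritten as multiples of
    \<open>\<eta> * N\<close> through this product, so 1/6 is what keeps them small.\<close>
  have \<eta>: "0 < \<eta>" "k\<^sup>2 * l * \<eta> = 1 / 6"
    using k l_pos by (auto simp: \<eta>_def k_def[symmetric])
  have yS: "y \<in> S" using y Y by auto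
  have gX: "?g \<in> X" using x yS by (rule Gx_in)
  have x'X: "x' \<in> X" unfolding x'_def using X x gX by (intro subspace_diff subspace_scale)

  have descent: "\<Phi> x' \<le> \<Phi> x - \<eta> / 2 * (norm ?G)\<^sup>2 - \<eta> / 4 * N + \<eta> * l\<^sup>2 / 2 * \<delta>"
  proof -
    have "\<Phi> x' \<le> \<Phi> x + inner (x' - x) ?G + (l * k + l / 2) * (norm (x' - x))\<^sup>2"
      unfolding k_def by (rule \<Phi>_upper[OF x x'X])
    \<comment> \<open>Polarisation between the gradient used and the true one leaves a reserve of
      \<open>- \<eta> / 2 * N\<close> to absorb errors.\<close>
    also have "inner (x' - x) ?G = - (\<eta> / 2) * ((norm ?G)\<^sup>2 + N - (norm (?g - ?G))\<^sup>2)"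
      by (simp add: x'_def N_def power2_norm_eq_inner algebra_simps inner_commute)
    also have "(norm (x' - x))\<^sup>2 = \<eta>\<^sup>2 * N"
      by (simp add: x'_def N_def power_mult_distrib)
    \<comment> \<open>With \<open>k\<close> \<ge> 1 the curvature becomes a multiple of
      \<open>k\<^sup>2 * l\<close>, and the term consumes exactly half of the reserve.\<close>
    also have "(l * k + l / 2) * (\<eta>\<^sup>2 * N) \<le> (3 / 2 * k\<^sup>2 * l) * (\<eta>\<^sup>2 * N)"
    proof (intro mult_right_mono)
      have "k \<le> k\<^sup>2" "1 \<le> k\<^sup>2" using k by (auto simp: power2_eq_square mult_ge1_I)
      then have "l * (k + 1 / 2) \<le> l * (3 / 2 * k\<^sup>2)" using l_pos by (intro mult_left_mono) auto
      then show "l * k + l / 2 \<le> 3 / 2 * k\<^sup>2 * l" by (simp add: algebra_simps)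
    qed (use nonneg in auto)
    also have "(3 / 2 * k\<^sup>2 * l) * (\<eta>\<^sup>2 * N) = 3 / 2 * (k\<^sup>2 * l * \<eta>) * \<eta> * N"
      by (simp add: power2_eq_square)
    also have "\<dots> = \<eta> / 4 * N" by (simp add: \<eta>)
    finally have "\<Phi> x' \<le> \<Phi> x - \<eta> / 2 * (norm ?G)\<^sup>2 - \<eta> / 4 * N + \<eta> / 2 * (norm (?g - ?G))\<^sup>2"
      by (simp add: algebra_simps)
    moreover have "(norm (?g - ?G))\<^sup>2 \<le> l\<^sup>2 * \<delta>"
      unfolding \<delta>_def power_mult_distrib[symmetric]
      using x yS by (intro power_mono Gx_lip2 ystar_in_S) auto
    then have "\<eta> / 2 * (norm (?g - ?G))\<^sup>2 \<le> \<eta> / 2 * (l\<^sup>2 * \<delta>)"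
      using \<eta> by (intro mult_left_mono) auto
    ultimately show ?thesis by (simp add: algebra_simps)
  qed

  have contraction: "\<delta>' \<le> (1 - 1 / (2 * k)) * \<delta> + 3 * k ^ 3 * \<eta>\<^sup>2 * N"
  proof -
    have "\<delta>' = (norm ((y' - ystar x) + (ystar x - ystar x')))\<^sup>2" by (simp add: \<delta>'_def)
    \<comment> \<open>Young's inequality with weight \<open>2 * k\<close> gives up half of the
      contraction gain \<open>1 / k\<close>, so a factor \<open>1 - 1 / (2 * k)\<close> survives;
      the price is a factor \<open>1 + 2 * k\<close> on the drift of the maximiser.\<close>
    also have "\<dots> \<le> (1 + 1 / (2 * k)) * (norm (y' - ystar x))\<^sup>2
        + (1 + 2 * k) * (norm (ystar x - ystar x'))\<^sup>2"
      using k by (intro norm_add_sq_le) auto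
    also have "\<dots> \<le> (1 - 1 / (2 * k)) * \<delta> + (3 * k) * (k\<^sup>2 * (\<eta>\<^sup>2 * N))"
    proof (rule add_mono)
      have "(norm (y' - ystar x))\<^sup>2 \<le> (1 - 1 / k) * \<delta>"
        using ascent_contraction[OF x y] l_pos \<mu>_pos
        by (simp add: y'_def \<delta>_def k_def field_simps)
      then have "(1 + 1 / (2 * k)) * (norm (y' - ystar x))\<^sup>2
          \<le> ((1 + 1 / (2 * k)) * (1 - 1 / k)) * \<delta>"
        using k unfolding mult.assoc by (intro mult_left_mono) auto
      also have "\<dots> \<le> (1 - 1 / (2 * k)) * \<delta>"
        using k nonneg by (intro mult_right_mono) (simp_all add: field_simps)
      finally show "(1 + 1 / (2 * k)) * (norm (y' - ystar x))\<^sup>2 \<le> (1 - 1 / (2 * k)) * \<delta>" .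
    next
      have "norm (ystar x - ystar x') \<le> k * norm (x - x')"
        unfolding k_def by (rule ystar_lip[OF x x'X])
      then have "(norm (ystar x - ystar x'))\<^sup>2 \<le> (k * norm (x - x'))\<^sup>2"
        by (intro power_mono) auto
      also have "\<dots> = k\<^sup>2 * (\<eta>\<^sup>2 * N)"
        by (simp add: x'_def N_def power_mult_distrib)
      finally show "(1 + 2 * k) * (norm (ystar x - ystar x'))\<^sup>2 \<le> (3 * k) * (k\<^sup>2 * (\<eta>\<^sup>2 * N))"
        using k by (intro mult_mono) auto
    qed
    finally show ?thesis by (simp add: power2_eq_square power3_eq_cube mult.assoc)
  qed
  \<comment> \<open>The weight in \<open>V\<close> turns the gain \<open>\<delta> / (2 * k)\<close>
    into \<open>\<eta> * l\<^sup>2 / 2 * \<delta>\<close>, the gradient error in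
    \<open>descent\<close>. The drift becomes \<open>\<eta> / 12 * N\<close>, within the remaining
    reserve \<open>\<eta> / 4 * N\<close>.\<close>
  have "k * \<eta> * l\<^sup>2 * \<delta>' \<le> k * \<eta> * l\<^sup>2 * ((1 - 1 / (2 * k)) * \<delta> + 3 * k ^ 3 * \<eta>\<^sup>2 * N)"
    using k \<eta> contraction by (intro mult_left_mono) auto
  also have "\<dots> = k * \<eta> * l\<^sup>2 * \<delta> - \<eta> * l\<^sup>2 / 2 * \<delta> + 3 * (k\<^sup>2 * l * \<eta>)\<^sup>2 * \<eta> * N"
    using k by (simp add: field_simps power2_eq_square power3_eq_cube)
  also have "3 * (k\<^sup>2 * l * \<eta>)\<^sup>2 * \<eta> * N = \<eta> / 12 * N"
    unfolding \<eta> by (simp add: power2_eq_square)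
  also have "\<dots> \<le> \<eta> / 4 * N"
    using \<eta> nonneg by (intro mult_right_mono) auto
  finally show ?thesis
    using descent unfolding V_def k_def[symmetric] \<delta>_def[symmetric] \<delta>'_def[symmetric] by simp
qed

end

section \<open>Coordinate spaces\<close>

definition unit_vec :: "nat \<Rightarrow> fseq" where
  "unit_vec i = Abs_fseq (\<lambda>j. if j = i then 1 else 0)"

lemma coord_unit_vec: "coord (unit_vec i) j = (if j = i then 1 else 0)"
  by (simp add: unit_vec_def Abs_fseq_inverse)

lemma coord_sum: "coord (sum h A) i = (\<Sum>a\<in>A. coord (h a) i)"
  by (induction A rule: infinite_finite_induct) auto

lemma unit_vec_in_Rn: "i < n \<Longrightarrow> unit_vec i \<in> Rn n"
  by (simp add: Rn_def coord_unit_vec)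

lemma Rn_expansion: "x \<in> Rn n \<Longrightarrow> x = (\<Sum>i<n. coord x i *\<^sub>R unit_vec i)"
  by (rule fseq_eqI) (auto simp: coord_sum coord_unit_vec Rn_def if_distrib cong: if_cong)

text \<open>Closed bounded sets of the full sequence space need not be compact, so the dimension
  enters by induction: each box is a continuous image of the previous box times an interval.\<close>

lemma compact_Rn_box: "compact {x \<in> Rn n. \<forall>i<n. \<bar>coord x i\<bar> \<le> B}"
proof (induction n)
  case 0
  have "{x \<in> Rn 0. \<forall>i<0. \<bar>coord x i\<bar> \<le> B} = {0}"
    by (auto simp: Rn_def intro: fseq_eqI)
  then show ?case by simp
next
  case (Suc n)
  let ?K = "\<lambda>n. {x \<in> Rn n. \<forall>i<n. \<bar>coord x i\<bar> \<le> B}"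
  let ?F = "\<lambda>(x, t). x + t *\<^sub>R unit_vec n"
  have "compact (?F ` (?K n \<times> {-B..B}))"
    unfolding split_beta
    by (intro compact_continuous_image compact_Times Suc compact_Icc continuous_intros)
  moreover have "?F ` (?K n \<times> {-B..B}) = ?K (Suc n)"
  proof (intro subset_antisym subsetI)
    fix z assume "z \<in> ?F ` (?K n \<times> {-B..B})"
    then show "z \<in> ?K (Suc n)"
      by (auto simp: Rn_def coord_unit_vec less_Suc_eq)
  next
    fix z assume z: "z \<in> ?K (Suc n)"
    let ?x = "z - coord z n *\<^sub>R unit_vec n"
    have "?x \<in> ?K n"
      using z by (auto simp: Rn_def coord_unit_vec Suc_le_eq)
    moreover have "coord z n \<in> {-B..B}" using z by auto
    moreover have "z = ?F (?x, coord z n)" by simp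
    ultimately show "z \<in> ?F ` (?K n \<times> {-B..B})" by blast
  qed
  ultimately show ?case by simp
qed

text \<open>Coordinates are inner products with unit vectors, so a norm bound places
  \<open>Y\<close> inside a compact box.\<close>

lemma compact_subset_Rn:
  assumes "Y \<subseteq> Rn n" "closed Y" "bounded Y"
  shows "compact Y"
proof -
  obtain B where B: "\<And>y. y \<in> Y \<Longrightarrow> norm y \<le> B"
    using \<open>bounded Y\<close> by (auto simp: bounded_iff)
  have "\<bar>coord y i\<bar> \<le> B" if "y \<in> Y" "i < n" for y i
  proof -
    have "coord y i = inner (unit_vec i) y"
      using that by (subst Rn_inner[OF unit_vec_in_Rn]) (auto simp: coord_unit_vec mult_delta_left)
    moreover have "norm (unit_vec i) = 1"
      using that by (subst Rn_norm[OF unit_vec_in_Rn])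
        (auto simp: coord_unit_vec power2_eq_square mult_delta_left)
    ultimately show ?thesis
      using Cauchy_Schwarz_ineq2[of "unit_vec i" y] B[OF that(1)] by simp
  qed
  then have "Y \<subseteq> {x \<in> Rn n. \<forall>i<n. \<bar>coord x i\<bar> \<le> B}" using assms by auto
  then have "{x \<in> Rn n. \<forall>i<n. \<bar>coord x i\<bar> \<le> B} \<inter> Y = Y" by (rule inf_absorb2)
  then show ?thesis
    using compact_Int_closed[OF compact_Rn_box[of n B] \<open>closed Y\<close>] by (simp only:)
qed

text \<open>Riesz representation by hand: the gradient's coordinates are the values of the
  derivative at the basis vectors.\<close>

lemma differentiable_imp_has_gradient:
  assumes f: "f differentiable_on (Rn m \<times> Rn n)" and z: "z \<in> Rn m \<times> Rn n"
  shows "has_gradient f (gradient (Rn m \<times> Rn n) f z) z (Rn m \<times> Rn n)"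
proof -
  let ?S = "Rn m \<times> Rn n"
  obtain F where F: "(f has_derivative F) (at z within ?S)"
    using f z by (auto simp: differentiable_on_def differentiable_def)
  interpret F: linear F using F by (rule has_derivative_linear)
  define g where "g = ((\<Sum>i<m. F (unit_vec i, 0) *\<^sub>R unit_vec i), (\<Sum>i<n. F (0, unit_vec i) *\<^sub>R unit_vec i))"
  have gS: "g \<in> ?S"
    by (auto simp: g_def intro!: subspace_sum[OF subspace_Rn] subspace_scale[OF subspace_Rn] unit_vec_in_Rn)
  have "F h = inner h g" if "h \<in> ?S" for h
  proof -
    obtain a b where h: "h = (a, b)" "a \<in> Rn m" "b \<in> Rn n" using \<open>h \<in> ?S\<close> by auto
    have "h = (a, 0) + (0, b)" by (simp add: h)
    also have "\<dots> = (\<Sum>i<m. coord a i *\<^sub>R (unit_vec i, 0)) + (\<Sum>i<n. coord b i *\<^sub>R (0, unit_vec i))"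
      using Rn_expansion[OF h(2)] Rn_expansion[OF h(3)]
      by (auto simp: prod_eq_iff fst_sum snd_sum)
    finally have "F h = (\<Sum>i<m. coord a i * F (unit_vec i, 0)) + (\<Sum>i<n. coord b i * F (0, unit_vec i))"
      by (simp only: F.add F.sum F.scaleR real_scaleR_def)
    also have "\<dots> = inner h g"
      by (simp add: h(1) g_def inner_prod_def Rn_inner[OF h(2)] Rn_inner[OF h(3)] coord_sum
          coord_unit_vec if_distrib cong: if_cong)
    finally show ?thesis .
  qed
  moreover have "subspace ?S" using subspace_Rn by (auto intro: subspace_Times)
  \<comment> \<open>The limit within \<open>?S\<close> evaluates \<open>F\<close> only at
    differences of points of \<open>?S\<close>, where it agrees with the inner product.\<close>
  ultimately have "(f has_derivative (\<lambda>h. inner h g)) (at z within ?S)"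
    using F z by (auto simp: has_derivative_within subspace_diff bounded_linear_inner_left
        cong: Lim_cong_within)
  then have "has_gradient f g z ?S" using gS by (simp add: has_gradient_def)
  then show ?thesis
    using gradient_eq[OF \<open>subspace ?S\<close> z] by simp
qed

text \<open>Compare the two quadratic models around 0 at a nonzero point: one has curvature at least
  \<mu>, the other at most \<open>l\<close>.\<close>

lemma strong_concavity_le_smoothness:
  assumes S: "subspace S" "u \<in> S" "u \<noteq> 0" and conc: "strongly_concave_on S \<mu> f"
    and g: "\<And>z. z \<in> S \<Longrightarrow> has_gradient f (g z) z S"
    and lip: "\<And>z z'. z \<in> S \<Longrightarrow> z' \<in> S \<Longrightarrow> norm (g z - g z') \<le> l * norm (z - z')"
  shows "\<mu> \<le> l"
proof -
  have 0: "0 \<in> S" using S by (simp add: subspace_0)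
  have "f u \<le> f 0 + inner (u - 0) (g 0) - \<mu> / 2 * (norm (u - 0))\<^sup>2"
    using S 0 conc g by (intro strongly_concave_gradient)
  moreover have "f 0 + inner (u - 0) (g 0) - l / 2 * (norm (u - 0))\<^sup>2 \<le> f u"
    using S 0 g lip by (intro smooth_lower_bound)
  ultimately have "\<mu> * (norm u)\<^sup>2 \<le> l * (norm u)\<^sup>2" by simp
  then show ?thesis using S by simp
qed

section \<open>Convergence\<close>

lemma minimax_Rn:
  assumes n: "n \<ge> 1" and \<mu>: "\<mu> > 0"
    and smooth: "l_smooth_on (Rn m \<times> Rn n) l f"
    and conc: "\<forall>x\<in>Rn m. strongly_concave_on (Rn n) \<mu> (\<lambda>y. f (x, y))"
    and Y: "Y \<subseteq> Rn n" "Y \<noteq> {}" "closed Y" "convex Y" "bounded Y"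
  shows "minimax f (Rn m) (Rn n) Y (gradient (Rn m \<times> Rn n) f) l \<mu>"
proof
  let ?G = "gradient (Rn m \<times> Rn n) f"
  show grad: "has_gradient f (?G z) z (Rn m \<times> Rn n)" if "z \<in> Rn m \<times> Rn n" for z
    using smooth that by (intro differentiable_imp_has_gradient) (auto simp: l_smooth_on_def)
  show lip: "norm (?G z - ?G z') \<le> l * norm (z - z')"
    if "z \<in> Rn m \<times> Rn n" "z' \<in> Rn m \<times> Rn n" for z z'
    using smooth that unfolding l_smooth_on_def by blast
  have 0: "0 \<in> Rn m" by (rule subspace_0[OF subspace_Rn])
  show "\<mu> \<le> l"
  proof (rule strong_concavity_le_smoothness[OF subspace_Rn])
    \<comment> \<open>Positive dimension \<open>n\<close> supplies the nonzero direction.\<close>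
    show "unit_vec 0 \<in> Rn n" using n by (simp add: unit_vec_in_Rn)
    show "unit_vec 0 \<noteq> 0" using coord_unit_vec[of 0 0] by auto
    show "strongly_concave_on (Rn n) \<mu> (\<lambda>y. f (0, y))" using conc 0 by blast
    show "has_gradient (\<lambda>y. f (0, y)) (snd (?G (0, y))) y (Rn n)" if "y \<in> Rn n" for y
      using that 0 by (intro has_gradient_snd[OF grad]) auto
    show "norm (snd (?G (0, y)) - snd (?G (0, y'))) \<le> l * norm (y - y')"
      if "y \<in> Rn n" "y' \<in> Rn n" for y y'
    proof -
      have "norm (snd (?G (0, y) - ?G (0, y'))) \<le> norm (?G (0, y) - ?G (0, y'))"
        by (metis norm_snd_le prod.collapse)
      also have "\<dots> \<le> l * norm ((0, y) - (0, y') :: fseq \<times> fseq)"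
        using that 0 by (intro lip) auto
      finally show ?thesis by (simp add: norm_Pair)
    qed
  qed
  show "compact Y" using Y by (intro compact_subset_Rn)
qed (use \<mu> conc Y in \<open>auto simp: subspace_Rn\<close>)

lemma gda_sum_le:
  fixes m n :: nat and f :: "fseq \<times> fseq \<Rightarrow> real" and Y :: "fseq set" and l \<mu> :: real
    and x0 y0 :: fseq
  defines "\<Phi> \<equiv> max_over Y f" and "\<eta> \<equiv> (1 / 6) / ((l / \<mu>)\<^sup>2 * l)"
  defines "xs \<equiv> \<lambda>t. fst (gda m n f Y \<eta> (1 / l) x0 y0 t)"
  assumes M: "minimax f (Rn m) (Rn n) Y (gradient (Rn m \<times> Rn n) f) l \<mu>"
    and "bounded Y" and bdd: "bdd_below (\<Phi> ` Rn m)" and x0: "x0 \<in> Rn m" and y0: "y0 \<in> Y"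
  shows "\<Phi> differentiable_on Rn m"
    and "(\<Sum>t\<in>{1..T}. (norm (gradient (Rn m) \<Phi> (xs t)))\<^sup>2)
      \<le> 12 * ((l / \<mu>)\<^sup>2 * l * (\<Phi> x0 - (INF x\<in>Rn m. \<Phi> x)) + l / \<mu> * l\<^sup>2 * (diameter Y)\<^sup>2)"
proof -
  interpret minimax f "Rn m" "Rn n" Y "gradient (Rn m \<times> Rn n) f" l \<mu> by (rule M)
  define ys where "ys t = snd (gda m n f Y \<eta> (1 / l) x0 y0 t)" for t
  define k where "k = l / \<mu>"
  let ?W = "\<lambda>t. V \<eta> (xs t) (ys t)" and ?N = "\<lambda>t. (norm (gradient (Rn m) \<Phi> (xs t)))\<^sup>2"
  let ?inf = "INF x\<in>Rn m. \<Phi> x"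
  have k: "0 < k" using l_pos \<mu>_pos by (simp add: k_def)
  have \<eta>: "0 < \<eta>" "12 * (k\<^sup>2 * l) * \<eta> = 2"
    using k l_pos by (auto simp: \<eta>_def k_def[symmetric])
  \<comment> \<open>The partial gradients computed by \<open>gda\<close> are the components of the
    joint gradient.\<close>
  have gradx: "gradient (Rn m) (\<lambda>x'. f (x', y)) x = Gx x y" if "x \<in> Rn m" "y \<in> Rn n" for x y
    using that by (intro gradient_eq subspace_Rn has_gradient_Gx)
  have grady: "gradient (Rn n) (\<lambda>y'. f (x, y')) y = Gy x y" if "x \<in> Rn m" "y \<in> Rn n" for x y
    using that by (intro gradient_eq subspace_Rn has_gradient_Gy)
  have grad\<Phi>: "gradient (Rn m) \<Phi> x = Gx x (ystar x)" if "x \<in> Rn m" for x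
    unfolding \<Phi>_def using that by (intro gradient_eq subspace_Rn has_gradient_\<Phi>)
  show "\<Phi> differentiable_on Rn m"
    unfolding \<Phi>_def differentiable_on_def differentiable_def
    using has_gradient_\<Phi> by (auto simp: has_gradient_def)

  have step: "xs (Suc t) = xs t - \<eta> *\<^sub>R Gx (xs t) (ys t)"
      "ys (Suc t) = proj Y (ys t + (1 / l) *\<^sub>R Gy (xs t) (ys t))"
    if "xs t \<in> Rn m" "ys t \<in> Y" for t
    using that Y(1)
    by (auto simp: xs_def ys_def Let_def split_beta subset_iff gradx[symmetric] grady[symmetric])
  have inv: "xs t \<in> Rn m \<and> ys t \<in> Y" for t
  proof (induction t)
    case 0
    then show ?case using x0 y0 by (simp add: xs_def ys_def)
  next
    case (Suc t)
    then have "Gx (xs t) (ys t) \<in> Rn m" using Y(1) by (intro Gx_in) auto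
    then show ?case
      using Suc step[of t] proj_compact_convex(1)[OF Y(3,4,2)]
      by (auto intro: subspace_diff[OF subspace_Rn] subspace_scale[OF subspace_Rn])
  qed
  have decrease: "?W (Suc t) \<le> ?W t - \<eta> / 2 * ?N t" for t
    using V_decrease[of "xs t" "ys t"] inv[of t] step[of t] grad\<Phi>[of "xs t"]
    by (simp add: \<eta>_def)
  \<comment> \<open>The output is drawn from iterates 1 to \<open>T\<close>, so the sum starts at
    \<open>?W 1\<close>; step 0 then serves to pass to the initial data.\<close>
  have telescope: "\<eta> / 2 * (\<Sum>t\<in>{1..T}. ?N t) \<le> ?W 1 - ?W (Suc T)"
  proof (induction T)
    case (Suc T)
    then show ?case using decrease[of "Suc T"] by (simp add: algebra_simps)
  qed simp
  have "?W 1 \<le> ?W 0"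
  proof -
    have "0 \<le> \<eta> / 2 * ?N 0" using \<eta> by simp
    then show ?thesis using decrease[of 0] unfolding One_nat_def by linarith
  qed
  moreover have "?W 0 \<le> \<Phi> x0 + k * \<eta> * l\<^sup>2 * (diameter Y)\<^sup>2"
  proof -
    have "dist y0 (ystar x0) \<le> diameter Y"
      using \<open>bounded Y\<close> y0 ystar_in[OF x0] by (intro diameter_bounded_bound)
    then have "(norm (y0 - ystar x0))\<^sup>2 \<le> (diameter Y)\<^sup>2"
      by (intro power_mono) (auto simp: dist_norm)
    then have "k * \<eta> * l\<^sup>2 * (norm (y0 - ystar x0))\<^sup>2 \<le> k * \<eta> * l\<^sup>2 * (diameter Y)\<^sup>2"
      using k \<eta> by (intro mult_left_mono) auto
    then show ?thesis by (simp add: V_def xs_def ys_def \<Phi>_def k_def)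
  qed
  moreover have "?inf \<le> ?W (Suc T)"
  proof -
    have "?inf \<le> \<Phi> (xs (Suc T))" using bdd inv by (intro cINF_lower) auto
    moreover have "0 \<le> k * \<eta> * l\<^sup>2 * (norm (ys (Suc T) - ystar (xs (Suc T))))\<^sup>2"
      using k \<eta> by simp
    ultimately show ?thesis by (simp add: V_def \<Phi>_def k_def)
  qed
  ultimately have "\<eta> / 2 * (\<Sum>t\<in>{1..T}. ?N t) \<le> (\<Phi> x0 - ?inf) + k * \<eta> * l\<^sup>2 * (diameter Y)\<^sup>2"
    using telescope by linarith
  \<comment> \<open>The factor equals \<open>2 / \<eta>\<close> and clears the stepsize; it is the
    source of the constant 12.\<close>
  then have "12 * (k\<^sup>2 * l) * (\<eta> / 2 * (\<Sum>t\<in>{1..T}. ?N t))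
      \<le> 12 * (k\<^sup>2 * l) * ((\<Phi> x0 - ?inf) + k * \<eta> * l\<^sup>2 * (diameter Y)\<^sup>2)"
    using k l_pos by (intro mult_left_mono) auto
  also have "12 * (k\<^sup>2 * l) * (\<eta> / 2 * (\<Sum>t\<in>{1..T}. ?N t)) =
      (12 * (k\<^sup>2 * l) * \<eta>) * (\<Sum>t\<in>{1..T}. ?N t) / 2" by simp
  also have "\<dots> = (\<Sum>t\<in>{1..T}. ?N t)" unfolding \<eta> by simp
  also have "12 * (k\<^sup>2 * l) * ((\<Phi> x0 - ?inf) + k * \<eta> * l\<^sup>2 * (diameter Y)\<^sup>2)
      = 12 * (k\<^sup>2 * l * (\<Phi> x0 - ?inf)) + (12 * (k\<^sup>2 * l) * \<eta>) * (k * l\<^sup>2 * (diameter Y)\<^sup>2)"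
    by (simp add: algebra_simps)
  \<comment> \<open>The diameter term carries only a factor 2, enlarged to share one
    constant.\<close>
  also have "\<dots> \<le> 12 * (k\<^sup>2 * l * (\<Phi> x0 - ?inf) + k * l\<^sup>2 * (diameter Y)\<^sup>2)"
    unfolding \<eta> using k by simp
  finally show "(\<Sum>t\<in>{1..T}. ?N t) \<le>
      12 * ((l / \<mu>)\<^sup>2 * l * (\<Phi> x0 - ?inf) + l / \<mu> * l\<^sup>2 * (diameter Y)\<^sup>2)"
    unfolding k_def .
qed

theorem theorem4p4:
  shows "\<exists>cx cy C :: real. cx > 0 \<and> cy > 0 \<and> C > 0 \<and>
    (\<forall>(m::nat) (n::nat) (f :: fseq \<times> fseq \<Rightarrow> real) (Y :: fseq set)
       (l::real) (\<mu>::real) (D::real) (\<epsilon>::real) (x0::fseq) (y0::fseq) (T::nat).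
       let \<kappa> = l / \<mu>;
           \<Phi> = max_over Y f;
           \<Delta> = \<Phi> x0 - (INF x\<in>Rn m. \<Phi> x);
           \<eta>x = cx / (\<kappa>\<^sup>2 * l);
           \<eta>y = cy / l
       in
         m \<ge> 1 \<longrightarrow> n \<ge> 1 \<longrightarrow> l > 0 \<longrightarrow> \<mu> > 0 \<longrightarrow>
         l_smooth_on (Rn m \<times> Rn n) l f \<longrightarrow>
         (\<forall>x\<in>Rn m. strongly_concave_on (Rn n) \<mu> (\<lambda>y. f (x, y))) \<longrightarrow>
         Y \<subseteq> Rn n \<longrightarrow> Y \<noteq> {} \<longrightarrow> closed Y \<longrightarrow> convex Y \<longrightarrow> bounded Y \<longrightarrow> diameter Y = D \<longrightarrow>
         bdd_below (\<Phi> ` Rn m) \<longrightarrow>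
         \<epsilon> > 0 \<longrightarrow> x0 \<in> Rn m \<longrightarrow> y0 \<in> Y \<longrightarrow> T \<ge> 1 \<longrightarrow>
         real T \<ge> C * ((\<kappa>\<^sup>2 * l * \<Delta> + \<kappa> * l\<^sup>2 * D\<^sup>2) / \<epsilon>\<^sup>2) \<longrightarrow>
         \<Phi> differentiable_on Rn m \<and>
         measure_pmf.expectation (gda_output m n f Y \<eta>x \<eta>y x0 y0 T)
           (\<lambda>x. (norm (gradient (Rn m) \<Phi> x))\<^sup>2) \<le> \<epsilon>\<^sup>2)"
proof (rule exI[of _ "1 / 6"], rule exI[of _ 1], rule exI[of _ 12], unfold Let_def,
    intro conjI allI impI)
  fix m n :: nat and f :: "fseq \<times> fseq \<Rightarrow> real" and Y :: "fseq set"
    and l \<mu> D \<epsilon> :: real and x0 y0 :: fseq and T :: nat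
  let ?\<eta> = "(1 / 6) / ((l / \<mu>)\<^sup>2 * l)" and ?\<Phi> = "max_over Y f"
  let ?B = "(l / \<mu>)\<^sup>2 * l * (?\<Phi> x0 - (INF x\<in>Rn m. ?\<Phi> x)) + l / \<mu> * l\<^sup>2 * D\<^sup>2"
  assume "n \<ge> 1" "\<mu> > 0" "l_smooth_on (Rn m \<times> Rn n) l f"
    "\<forall>x\<in>Rn m. strongly_concave_on (Rn n) \<mu> (\<lambda>y. f (x, y))"
    "Y \<subseteq> Rn n" "Y \<noteq> {}" "closed Y" "convex Y" and "bounded Y" and D: "diameter Y = D"
    and bdd: "bdd_below (?\<Phi> ` Rn m)" and \<epsilon>: "\<epsilon> > 0" and x0: "x0 \<in> Rn m" and y0: "y0 \<in> Y"
    and T: "T \<ge> 1" "real T \<ge> 12 * (?B / \<epsilon>\<^sup>2)"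
  then have M: "minimax f (Rn m) (Rn n) Y (gradient (Rn m \<times> Rn n) f) l \<mu>"
    by (intro minimax_Rn)
  note * = gda_sum_le[OF M \<open>bounded Y\<close> bdd x0 y0, unfolded D]
  show "?\<Phi> differentiable_on Rn m" by (rule *)
  \<comment> \<open>A uniform draw makes the expectation the average over iterates 1 to
    \<open>T\<close>; \<open>T\<close> \<ge> 1 makes that set nonempty.\<close>
  have "measure_pmf.expectation (gda_output m n f Y ?\<eta> (1 / l) x0 y0 T)
      (\<lambda>x. (norm (gradient (Rn m) ?\<Phi> x))\<^sup>2)
      = (\<Sum>t\<in>{1..T}. (norm (gradient (Rn m) ?\<Phi> (fst (gda m n f Y ?\<eta> (1 / l) x0 y0 t))))\<^sup>2) / T"
    using T by (simp add: gda_output_def integral_pmf_of_set)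
  also have "\<dots> \<le> 12 * ?B / T"
    using *(2) by (rule divide_right_mono) simp
  also have "\<dots> \<le> \<epsilon>\<^sup>2"
    using T \<epsilon> by (simp add: field_simps)
  finally show "measure_pmf.expectation (gda_output m n f Y ?\<eta> (1 / l) x0 y0 T)
      (\<lambda>x. (norm (gradient (Rn m) ?\<Phi> x))\<^sup>2) \<le> \<epsilon>\<^sup>2" .
qed simp_all

end
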